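(* Let $X$ be a completely regular Hausdorff space with $|X|>1$. Then the line graph $L(\Gamma(C(X)))$ is both triangulated and hypertriangulated.
   Context: $C(X)$ is the ring of all continuous functions $X\to\mathbb{R}$ with pointwise operations. For $f\in C(X)$, $Z(f)=\{x\in X: f(x)=0\}$. $\Gamma(C(X))$ is the simple graph whose vertex set is the set of non-units of $C(X)$ (equivalently, the $f$ with $Z(f)\neq\emptyset$), two distinct vertices $f,g$ being adjacent iff $Z(f)\cap Z(g)\neq\emptyset$. Its line graph $L(\Gamma(C(X)))$ has as vertices the unordered pairs $[f,g]=[g,f]$ of distinct vertices $f,g$ of $\Gamma(C(X))$ with $Z(f)\cap Z(g)\neq\emptyset$; two distinct vertices $[f_1,f_2]$, $[g_1,g_2]$ are adjacent iff $f_i=g_j$ for some $i,j\in\{1,2\}$. A graph is triangulated if every vertex lies on a triangle (3-cycle), and hypertriangulated if every edge lies on a triangle. *)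

theory Defs
  imports "HOL-Analysis.Analysis" "HOL-Algebra.Ring"
begin

text \<open>
  A continuous function on a topological space \<open>X\<close> is represented by its extensional
  representative (\<open>undefined\<close> outside \<open>topspace X\<close>), so that equality in HOL is equality of
  functions on \<open>X\<close>.
\<close>

definition cont_ring :: "'a topology \<Rightarrow> ('a \<Rightarrow> real) ring" where
  "cont_ring X =
    \<lparr>carrier = {f \<in> extensional (topspace X). continuous_map X euclideanreal f},
     monoid.mult = (\<lambda>f g. \<lambda>x\<in>topspace X. f x * g x),
     one = (\<lambda>x\<in>topspace X. 1),
     zero = (\<lambda>x\<in>topspace X. 0),
     add = (\<lambda>f g. \<lambda>x\<in>topspace X. f x + g x)\<rparr>"

definition zero_set :: "'a topology \<Rightarrow> ('a \<Rightarrow> real) \<Rightarrow> 'a set" where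
  "zero_set X f = {x \<in> topspace X. f x = 0}"

text \<open>
  An edge is the two-element set of its endpoints; the unordered pair \<open>[f, g]\<close> of distinct
  vertices is thus \<open>{f, g}\<close>, both as an edge of a graph and as a vertex of its line graph.
\<close>

record 'v sgraph =
  verts :: "'v set"
  edges :: "'v set set"

definition wf_sgraph :: "'v sgraph \<Rightarrow> bool" where
  "wf_sgraph G \<longleftrightarrow> (\<forall>e\<in>edges G. \<exists>u\<in>verts G. \<exists>v\<in>verts G. u \<noteq> v \<and> e = {u, v})"

definition line_graph :: "'v sgraph \<Rightarrow> 'v set sgraph" where
  "line_graph G =
    \<lparr>verts = edges G,
     edges = {{d, e} | d e. d \<in> edges G \<and> e \<in> edges G \<and> d \<noteq> e \<and> d \<inter> e \<noteq> {}}\<rparr>"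

definition is_triangle :: "'v sgraph \<Rightarrow> 'v \<Rightarrow> 'v \<Rightarrow> 'v \<Rightarrow> bool" where
  "is_triangle G u v w \<longleftrightarrow>
    u \<in> verts G \<and> v \<in> verts G \<and> w \<in> verts G \<and> u \<noteq> v \<and> v \<noteq> w \<and> w \<noteq> u \<and>
    {u, v} \<in> edges G \<and> {v, w} \<in> edges G \<and> {w, u} \<in> edges G"

definition triangulated :: "'v sgraph \<Rightarrow> bool" where
  "triangulated G \<longleftrightarrow> (\<forall>u\<in>verts G. \<exists>v w. is_triangle G u v w)"

definition hypertriangulated :: "'v sgraph \<Rightarrow> bool" where
  "hypertriangulated G \<longleftrightarrow> (\<forall>e\<in>edges G. \<exists>u v w. e = {u, v} \<and> is_triangle G u v w)"

definition zero_set_graph :: "'a topology \<Rightarrow> ('a \<Rightarrow> real) sgraph" where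
  "zero_set_graph X =
    (let V = carrier (cont_ring X) - Units (cont_ring X) in
     \<lparr>verts = V,
      edges = {{f, g} | f g. f \<in> V \<and> g \<in> V \<and> f \<noteq> g \<and> zero_set X f \<inter> zero_set X g \<noteq> {}}\<rparr>)"

lemma wf_zero_set_graph: "wf_sgraph (zero_set_graph X)"
  unfolding wf_sgraph_def zero_set_graph_def Let_def by auto

lemma wf_line_graph: "wf_sgraph (line_graph G)"
  unfolding wf_sgraph_def line_graph_def by auto

lemma cont_ring_cring: "cring (cont_ring X)"
proof (rule cringI)
  show "abelian_group (cont_ring X)"
  proof (rule abelian_groupI)
    fix f assume f: "f \<in> carrier (cont_ring X)"
    then have "(\<lambda>x\<in>topspace X. - f x) \<in> carrier (cont_ring X)"
      by (auto simp: cont_ring_def intro: continuous_map_eq[where f = "\<lambda>x. - f x"])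
    moreover have "(\<lambda>x\<in>topspace X. - f x) \<oplus>\<^bsub>cont_ring X\<^esub> f = \<zero>\<^bsub>cont_ring X\<^esub>"
      by (auto simp: cont_ring_def fun_eq_iff)
    ultimately show "\<exists>g\<in>carrier (cont_ring X). g \<oplus>\<^bsub>cont_ring X\<^esub> f = \<zero>\<^bsub>cont_ring X\<^esub>"
      by blast
  next
    fix f g assume "f \<in> carrier (cont_ring X)" "g \<in> carrier (cont_ring X)"
    then show "f \<oplus>\<^bsub>cont_ring X\<^esub> g \<in> carrier (cont_ring X)"
      by (auto simp: cont_ring_def
          intro: continuous_map_eq[where f = "\<lambda>x. f x + g x"] continuous_map_add)
  qed (auto simp: cont_ring_def fun_eq_iff extensional_def algebra_simps
         intro: continuous_map_eq[where f = "\<lambda>x. 0"])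
  show "comm_monoid (cont_ring X)"
  proof (rule comm_monoidI)
    fix f g assume "f \<in> carrier (cont_ring X)" "g \<in> carrier (cont_ring X)"
    then show "f \<otimes>\<^bsub>cont_ring X\<^esub> g \<in> carrier (cont_ring X)"
      by (auto simp: cont_ring_def
          intro: continuous_map_eq[where f = "\<lambda>x. f x * g x"] continuous_map_real_mult)
  qed (auto simp: cont_ring_def fun_eq_iff extensional_def algebra_simps
         intro: continuous_map_eq[where f = "\<lambda>x. 1"])
qed (auto simp: cont_ring_def fun_eq_iff algebra_simps)

lemma nonunit_cont_ring_iff:
  assumes "f \<in> carrier (cont_ring X)"
  shows "f \<notin> Units (cont_ring X) \<longleftrightarrow> zero_set X f \<noteq> {}"
proof
  assume "f \<notin> Units (cont_ring X)"
  show "zero_set X f \<noteq> {}"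
  proof
    assume "zero_set X f = {}"
    then have nz: "\<And>x. x \<in> topspace X \<Longrightarrow> f x \<noteq> 0"
      by (auto simp: zero_set_def)
    let ?g = "\<lambda>x\<in>topspace X. inverse (f x)"
    have "continuous_map X euclideanreal (\<lambda>x. inverse (f x))"
      using assms nz by (auto simp: cont_ring_def intro!: continuous_map_real_inverse)
    then have "?g \<in> carrier (cont_ring X)"
      by (auto simp: cont_ring_def intro: continuous_map_eq)
    moreover have "?g \<otimes>\<^bsub>cont_ring X\<^esub> f = \<one>\<^bsub>cont_ring X\<^esub>"
      "f \<otimes>\<^bsub>cont_ring X\<^esub> ?g = \<one>\<^bsub>cont_ring X\<^esub>"
      using nz by (auto simp: cont_ring_def fun_eq_iff)
    ultimately have "f \<in> Units (cont_ring X)"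
      using assms by (auto simp: Units_def)
    with \<open>f \<notin> Units (cont_ring X)\<close> show False ..
  qed
next
  assume "zero_set X f \<noteq> {}"
  then obtain x where x: "x \<in> topspace X" "f x = 0"
    by (auto simp: zero_set_def)
  show "f \<notin> Units (cont_ring X)"
  proof
    assume "f \<in> Units (cont_ring X)"
    then obtain g where "g \<otimes>\<^bsub>cont_ring X\<^esub> f = \<one>\<^bsub>cont_ring X\<^esub>"
      by (auto simp: Units_def)
    then have "(g \<otimes>\<^bsub>cont_ring X\<^esub> f) x = \<one>\<^bsub>cont_ring X\<^esub> x"
      by simp
    with x show False
      by (simp add: cont_ring_def)
  qed
qed

end

(* All edges through a common vertex form a clique in the line graph, so it suffices that every
   vertex of the zero-set graph has at least three neighbours. If f vanishes at x, complete
   regularity yields a nonzero continuous u with u x = 0, and the infinitely many multiples c u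
   are all, except possibly f itself, neighbours of f. *)
theory Submission imports Defs begin

text \<open>Pairs \<open>{u, v}\<close> and \<open>{u, w}\<close> with \<open>v \<noteq> w\<close>
  always differ, even if one of them collapses to \<open>{u}\<close>, so distinctness of the far
  ends gives all distinctness that the triangle requires.\<close>

lemma is_triangle_line_graph_star:
  assumes "{u, p} \<in> edges G" "{u, q} \<in> edges G" "{u, r} \<in> edges G"
    and "p \<noteq> q" "q \<noteq> r" "r \<noteq> p"
  shows "is_triangle (line_graph G) {u, p} {u, q} {u, r}"
proof -
  have star: "{{u, v}, {u, w}} \<in> edges (line_graph G)"
    if "{u, v} \<in> edges G" "{u, w} \<in> edges G" "v \<noteq> w" for v w
  proof -
    have "{u, v} \<noteq> {u, w}" "{u, v} \<inter> {u, w} \<noteq> {}"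
      using that(3) by (auto simp: doubleton_eq_iff)
    then show ?thesis
      using that(1,2) by (auto simp: line_graph_def)
  qed
  show ?thesis
    unfolding is_triangle_def
    using assms(1-3) star[OF assms(1,2,4)] star[OF assms(2,3,5)] star[OF assms(3,1,6)] assms(4-6)
    by (simp add: line_graph_def doubleton_eq_iff)
qed

context
  fixes G :: "'v sgraph"
  assumes wf: "wf_sgraph G"
    and three_neighbours: "\<And>u p q. u \<in> verts G \<Longrightarrow> \<exists>r. r \<noteq> p \<and> r \<noteq> q \<and> {u, r} \<in> edges G"
begin

text \<open>Avoiding any two prescribed vertices expresses having at least three neighbours without
  cardinalities. Starting from the pair \<open>{u, p}\<close>, either end may serve as centre:
  \<open>q\<close> avoids \<open>p\<close>, then \<open>r\<close> avoids both.\<close>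

lemma triangulated_line_graph: "triangulated (line_graph G)"
  unfolding triangulated_def
proof
  fix d assume "d \<in> verts (line_graph G)"
  then have d: "d \<in> edges G"
    by (simp add: line_graph_def)
  with wf obtain u p where u: "u \<in> verts G" and dup: "d = {u, p}"
    unfolding wf_sgraph_def by blast
  obtain q where q: "q \<noteq> p" "{u, q} \<in> edges G"
    using three_neighbours[OF u] by blast
  obtain r where r: "r \<noteq> p" "r \<noteq> q" "{u, r} \<in> edges G"
    using three_neighbours[OF u] by blast
  have "is_triangle (line_graph G) d {u, q} {u, r}"
    unfolding dup using d dup q r by (intro is_triangle_line_graph_star) simp_all
  then show "\<exists>v w. is_triangle (line_graph G) d v w"
    by blast
qed

text \<open>The centre is now forced to be the endpoint \<open>u\<close> shared by \<open>d\<close>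
  and \<open>e\<close>; a third edge at \<open>u\<close> closes the triangle.\<close>

lemma hypertriangulated_line_graph: "hypertriangulated (line_graph G)"
  unfolding hypertriangulated_def
proof
  fix a assume "a \<in> edges (line_graph G)"
  then obtain d e where a: "a = {d, e}" and d: "d \<in> edges G" and e: "e \<in> edges G"
    and "d \<noteq> e" "d \<inter> e \<noteq> {}"
    by (auto simp: line_graph_def)
  then obtain u where "u \<in> d" "u \<in> e"
    by blast
  \<comment> \<open>The shared vertex may be either end of each edge; this rewrites the pair with
    \<open>u\<close> in front.\<close>
  have endpoint: "u \<in> verts G \<and> (\<exists>p. c = {u, p})" if "c \<in> edges G" "u \<in> c" for c
  proof -
    from wf that(1) obtain v w where "v \<in> verts G" "w \<in> verts G" "c = {v, w}"
      unfolding wf_sgraph_def by blast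
    with that(2) show ?thesis
      by auto
  qed
  obtain p q where u: "u \<in> verts G" and p: "d = {u, p}" and q: "e = {u, q}"
    using endpoint[OF d \<open>u \<in> d\<close>] endpoint[OF e \<open>u \<in> e\<close>] by blast
  obtain r where r: "r \<noteq> p" "r \<noteq> q" "{u, r} \<in> edges G"
    using three_neighbours[OF u] by blast
  have "p \<noteq> q"
    using \<open>d \<noteq> e\<close> p q by blast
  then have "is_triangle (line_graph G) d e {u, r}"
    unfolding p q using d e p q r by (intro is_triangle_line_graph_star) simp_all
  then show "\<exists>u v w. a = {u, v} \<and> is_triangle (line_graph G) u v w"
    using a by blast
qed

end

lemma infinite_cont_ring_vanishing_at:
  assumes "completely_regular_space X" "Hausdorff_space X"
    and x: "x \<in> topspace X" and y: "y \<in> topspace X" and "x \<noteq> y"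
  shows "infinite {f \<in> carrier (cont_ring X). f x = 0}"
proof -
  \<comment> \<open>The Hausdorff property makes \<open>{y}\<close> closed, so complete regularity
    can separate \<open>x\<close> from it.\<close>
  have "closedin X {y}"
    using assms(2) y by (simp add: closedin_Hausdorff_singleton)
  moreover have "x \<in> topspace X - {y}"
    using x \<open>x \<noteq> y\<close> by blast
  ultimately obtain u :: "'a \<Rightarrow> real"
    where "continuous_map X (top_of_set {0..1}) u" and u0: "u x = 0" and "u ` {y} \<subseteq> {1}"
    using assms(1) unfolding completely_regular_space_def by meson
  then have u1: "u y = 1"
    by simp
  have u: "continuous_map X euclideanreal u"
    using \<open>continuous_map X (top_of_set {0..1}) u\<close> by (simp add: continuous_map_in_subtopology)
  \<comment> \<open>Restricting to \<open>topspace X\<close> gives the extensional representative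
    required by the carrier.\<close>
  define m where "m c = (\<lambda>z\<in>topspace X. c * u z)" for c :: real
  have "m c \<in> {f \<in> carrier (cont_ring X). f x = 0}" for c
    using x u u0 by (auto simp: m_def cont_ring_def
        intro: continuous_map_eq[where f = "\<lambda>z. c * u z"] continuous_map_real_mult)
  then have "range m \<subseteq> {f \<in> carrier (cont_ring X). f x = 0}"
    by (rule image_subsetI)
  \<comment> \<open>Since \<open>u y = 1\<close>, evaluating \<open>m c\<close> at \<open>y\<close>
    recovers the scalar \<open>c\<close>.\<close>
  moreover have "inj m"
  proof (rule injI)
    fix c d assume "m c = m d"
    then have "m c y = m d y" by simp
    then show "c = d" using y u1 by (simp add: m_def)
  qed
  then have "infinite (range m)"
    by (simp add: finite_image_iff infinite_UNIV_char_0)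
  ultimately show ?thesis
    by (rule infinite_super)
qed

lemma zero_set_graph_three_neighbours:
  assumes "completely_regular_space X" "Hausdorff_space X"
    and "\<exists>x\<in>topspace X. \<exists>y\<in>topspace X. x \<noteq> y"
    and f: "f \<in> verts (zero_set_graph X)"
  shows "\<exists>r. r \<noteq> p \<and> r \<noteq> q \<and> {f, r} \<in> edges (zero_set_graph X)"
proof -
  have fV: "f \<in> carrier (cont_ring X) - Units (cont_ring X)"
    using f by (simp add: zero_set_graph_def Let_def)
  then obtain x where x: "x \<in> topspace X" "f x = 0"
    using nonunit_cont_ring_iff[of f X] by (auto simp: zero_set_def)
  obtain y where "y \<in> topspace X" "x \<noteq> y"
    using assms(3) by metis
  \<comment> \<open>Besides \<open>p\<close> and \<open>q\<close>, the function \<open>f\<close>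
    itself is removed because the graph has no loops.\<close>
  then have "infinite ({r \<in> carrier (cont_ring X). r x = 0} - {f, p, q})"
    using infinite_cont_ring_vanishing_at[OF assms(1,2) x(1)] by (intro Diff_infinite_finite) simp_all
  then have "{r \<in> carrier (cont_ring X). r x = 0} - {f, p, q} \<noteq> {}"
    by (rule infinite_imp_nonempty)
  then obtain r where r: "r \<in> carrier (cont_ring X)" "r x = 0" "r \<noteq> f" "r \<noteq> p" "r \<noteq> q"
    by blast
  \<comment> \<open>The common zero serves twice: it makes \<open>r\<close> a nonunit, hence a
    vertex, and it makes \<open>r\<close> adjacent to \<open>f\<close>.\<close>
  have common: "x \<in> zero_set X f \<inter> zero_set X r"
    using x r by (simp add: zero_set_def)
  then have "r \<notin> Units (cont_ring X)"
    using nonunit_cont_ring_iff[OF r(1)] by blast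
  then have "{f, r} \<in> edges (zero_set_graph X)"
    using fV r(1,3) common by (auto simp: zero_set_graph_def Let_def)
  with r show ?thesis
    by blast
qed

theorem theorem5p7:
  fixes X :: "'a topology"
  assumes "completely_regular_space X"
    and "Hausdorff_space X"
    and "\<exists>x\<in>topspace X. \<exists>y\<in>topspace X. x \<noteq> y"
  shows "triangulated (line_graph (zero_set_graph X)) \<and>
         hypertriangulated (line_graph (zero_set_graph X))"
  using triangulated_line_graph[OF wf_zero_set_graph zero_set_graph_three_neighbours[OF assms]]
    hypertriangulated_line_graph[OF wf_zero_set_graph zero_set_graph_three_neighbours[OF assms]]
  by blast

end
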